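(* Let $\alpha\in(0,1)$, $\lambda>0$, $L>0$. Assume that $g:\mathbb{R}^d\to[0,\infty)$ is Lipschitz continuous and $g\in C^1$ for $g(x)\neq0$. Let $P,Q\in\mathcal{P}(\mathbb{R}^d)$ satisfy $\mathbb{E}_P[g]<\infty$ and $\mathbb{E}_Q[g]<\infty$, and assume that $Q$ has finite first moment. Let $\Delta C(Q;P)=\mathrm{CVaR}_\alpha^{P,g}-\mathrm{CVaR}_\alpha^{Q,g}$, let $\phi^*$ be the maximizer of $\sup_{\phi\in\Gamma_L}\{\mathbb{E}_Q[\phi]-\log\mathbb{E}_P[e^\phi]\}$, where $\Gamma_L$ is the space of $L$-Lipschitz functions on $\mathbb{R}^d$, and for $y\in T(Q)=[\mathrm{VaR}_\alpha^{Q,g},\overline{\mathrm{VaR}}_\alpha^{Q,g}]$ define the potential function $$\Phi_Q^y=\phi^*-\frac{2\lambda}{1-\alpha}\,\Delta C(Q;P)\,(g-y)^+ .$$ For each $y\in T(Q)$, choosing the potential function $\Phi_Q^y$ induces the velocity field $v_Q^y=-\nabla_x\Phi_Q^y$, and we have $$v_Q^y(x)=\begin{cases}-\nabla_x\phi^*(x)+\dfrac{2\lambda}{1-\alpha}\,\Delta C(Q;P)\,\nabla_x g(x), & g(x)>y,\\[2mm] -\nabla_x\phi^*(x), & g(x)\le y.\end{cases}$$ If $T(Q)$ is a singleton set, the velocity field degenerates to $v_Q^{\mathrm{VaR}_\alpha^{Q,g}}$.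
   Context: $\mathcal{P}(\mathbb{R}^d)$ is the set of probability measures on $\mathbb{R}^d$; $P$ is the target distribution. When $Q$ has finite first moment, the maximizer $\phi^*$ is known to exist and to be unique on $\mathrm{supp}(Q)\cup\mathrm{supp}(P)$. VaR and CVaR. For $Q$ with $\mathbb{E}_Q[g]<\infty$, let $\Psi^{Q,g}(c)=Q(g\le c)$, $\mathrm{VaR}_\alpha^{Q,g}:=\inf\{c\in\mathbb{R}:\Psi^{Q,g}(c)\ge\alpha\}$ and $\overline{\mathrm{VaR}}_\alpha^{Q,g}:=\inf\{c\in\mathbb{R}:\Psi^{Q,g}(c)>\alpha\}$. The Conditional Value-at-Risk is $\mathrm{CVaR}_\alpha^{Q,g}=\inf_{y\in\mathbb{R}}\{y+\frac{1}{1-\alpha}\mathbb{E}_Q[(g-y)^+]\}$, and its set of minimizers is $T(Q)$. The potentials $\Phi_Q^y$, $y\in T(Q)$, are first variational (Clarke) subgradients at $Q$ of the loss functional $Q\mapsto D^L_{\mathrm{KL}}(Q\|P)+\lambda(\Delta C(Q;P))^2$, where $D^L_{\mathrm{KL}}(Q\|P)=\sup_{\phi\in\Gamma_L}\{\mathbb{E}_Q[\phi]-\log\mathbb{E}_P[e^\phi]\}$ is the Lipschitz-regularized Kullback–Leibler divergence; the velocity field is that of the associated Wasserstein gradient flow.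
   Formalization: The velocity formula is asserted at points where both φ* and Φ_Q^y are differentiable (shown to be almost every x), not at every x: φ* is only Lipschitz and (g−y)^+ may have a kink on {g=y} (e.g. g=|x|, y=1), where the gradients in the formula need not exist. *)

theory Defs
  imports "HOL-Probability.Probability"
begin

definition grad :: "('a::real_inner \<Rightarrow> real) \<Rightarrow> 'a \<Rightarrow> 'a" where
  "grad f x = (THE D. GDERIV f x :> D)"

definition VaR :: "real \<Rightarrow> 'a measure \<Rightarrow> ('a \<Rightarrow> real) \<Rightarrow> real" where
  "VaR \<alpha> Q g = Inf {c. measure Q {x \<in> space Q. g x \<le> c} \<ge> \<alpha>}"

definition VaR_upper :: "real \<Rightarrow> 'a measure \<Rightarrow> ('a \<Rightarrow> real) \<Rightarrow> real" where
  "VaR_upper \<alpha> Q g = Inf {c. measure Q {x \<in> space Q. g x \<le> c} > \<alpha>}"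

definition CVaR_objective ::
    "real \<Rightarrow> 'a measure \<Rightarrow> ('a \<Rightarrow> real) \<Rightarrow> real \<Rightarrow> real" where
  "CVaR_objective \<alpha> Q g y = y + 1 / (1 - \<alpha>) * (\<integral>x. max (g x - y) 0 \<partial>Q)"

definition CVaR :: "real \<Rightarrow> 'a measure \<Rightarrow> ('a \<Rightarrow> real) \<Rightarrow> real" where
  "CVaR \<alpha> Q g = (INF y. CVaR_objective \<alpha> Q g y)"

definition CVaR_minimizers :: "real \<Rightarrow> 'a measure \<Rightarrow> ('a \<Rightarrow> real) \<Rightarrow> real set" where
  "CVaR_minimizers \<alpha> Q g = {y. is_arg_min (CVaR_objective \<alpha> Q g) (\<lambda>_. True) y}"

definition CVaR_gap ::
    "real \<Rightarrow> ('a \<Rightarrow> real) \<Rightarrow> 'a measure \<Rightarrow> 'a measure \<Rightarrow> real" where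
  "CVaR_gap \<alpha> g Q P = CVaR \<alpha> P g - CVaR \<alpha> Q g"

definition Lip_space :: "real \<Rightarrow> ('a::metric_space \<Rightarrow> real) set" where
  "Lip_space L = {\<phi>. L-lipschitz_on UNIV \<phi>}"

(* E_P[exp phi] may be infinite for an unbounded Lipschitz function phi; the
   objective is then minus infinity, hence the extended real values.  E_Q[phi] is
   finite for every Lipschitz phi when Q has finite first moment. *)
definition DV_objective ::
    "'a measure \<Rightarrow> 'a measure \<Rightarrow> ('a \<Rightarrow> real) \<Rightarrow> ereal" where
  "DV_objective Q P \<phi> =
     ereal (\<integral>x. \<phi> x \<partial>Q) -
     (if integrable P (\<lambda>x. exp (\<phi> x)) then ereal (ln (\<integral>x. exp (\<phi> x) \<partial>P)) else \<infinity>)"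

definition potential ::
    "real \<Rightarrow> real \<Rightarrow> ('a \<Rightarrow> real) \<Rightarrow> 'a measure \<Rightarrow> 'a measure \<Rightarrow> ('a \<Rightarrow> real) \<Rightarrow>
     real \<Rightarrow> 'a \<Rightarrow> real" where
  "potential \<alpha> lam g P Q \<phi> y x =
     \<phi> x - 2 * lam / (1 - \<alpha>) * CVaR_gap \<alpha> g Q P * max (g x - y) 0"

(* Meaningful only at points where the potential is differentiable. *)
definition velocity ::
    "real \<Rightarrow> real \<Rightarrow> ('a::real_inner \<Rightarrow> real) \<Rightarrow> 'a measure \<Rightarrow> 'a measure \<Rightarrow>
     ('a \<Rightarrow> real) \<Rightarrow> real \<Rightarrow> 'a \<Rightarrow> 'a" where
  "velocity \<alpha> lam g P Q \<phi> y x = - grad (potential \<alpha> lam g P Q \<phi> y) x"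

end

(*
  For y <= z the slope of the CVaR objective on [y, z] lies between (Q(g <= y) - alpha) / (1 - alpha)
  and (Q(g < z) - alpha) / (1 - alpha), so the objective decreases strictly up to the lower quantile,
  is constant up to the upper one, and increases strictly afterwards.  The velocity formula is the
  chain rule off the level set {g = y}; on it, if phi and the potential are both differentiable and the
  coefficient is not 0, then (g - y)^+ is differentiable at a minimum and has gradient 0.
  Differentiability almost everywhere is Rademacher's theorem: directional derivatives exist almost
  everywhere by the one-dimensional case and Tonelli, they are additive in the direction because their
  integrals over boxes are, and a Lipschitz function whose derivatives along rational directions
  depend linearly on the direction is differentiable.
*)
theory Submission
  imports Defs
begin

section \<open>One-sided derivatives of Lipschitz functions on the line\<close>

lemma negligible_imp_AE_lborel:
  fixes N :: "'a::euclidean_space set"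
  assumes "negligible N"
  shows "AE x in lborel. x \<notin> N"
  using assms AE_not_in[of N lebesgue] by (simp add: negligible_iff_null_sets AE_completion_iff)

text \<open>The image measure of Lebesgue measure under the inverse of \<open>G\<close> assigns \<open>G b - G a\<close> to an
  interval and is absolutely continuous because \<open>G\<close> maps null sets to null sets. Its density is
  then the right derivative at almost every point.\<close>

lemma right_derivative_exists_AE_of_expansive:
  fixes G :: "real \<Rightarrow> real"
  assumes lip: "K-lipschitz_on UNIV G"
    and exp: "\<And>x y. x \<le> y \<Longrightarrow> y - x \<le> G y - G x"
  shows "AE x in lborel. \<exists>l. ((\<lambda>h. (G (x + h) - G x) / h) \<longlongrightarrow> l) (at_right 0)"
proof -
  have mono: "strict_mono G"
    using exp by (auto simp: strict_mono_def) (smt (verit))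
  have inj: "inj G"
    using mono by (simp add: strict_mono_on_imp_inj_on)
  have contG: "continuous_on UNIV G"
    using lip by (rule lipschitz_on_continuous_on)
  have "\<exists>x. G x = z" for z
  proof -
    \<comment> \<open>Growth at least that of the identity gives \<open>G c >= G 0 + c >= z\<close>
      and \<open>G (- c) <= G 0 - c <= z\<close>, so the intermediate value theorem applies on
      \<open>[-c, c]\<close>.\<close>
    define c where "c = \<bar>z - G 0\<bar>"
    have "G (- c) \<le> z" "z \<le> G c"
      using exp[of "- c" 0] exp[of 0 c] by (auto simp: c_def abs_if split: if_splits)
    then show ?thesis
      using IVT'[of G "-c" z c] contG by (auto simp: c_def intro: continuous_on_subset)
  qed
  then have surj: "surj G" by (metis surjI)
  define k where "k = inv G"
  have Gk [simp]: "G (k z) = z" and kG [simp]: "k (G x) = x" for x z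
    using surj inj by (auto simp: k_def surj_f_inv_f)
  have vimage: "k -` A = G ` A" for A
    by (auto simp: image_iff) (metis Gk)+
  have "1-lipschitz_on UNIV k"
  proof (rule lipschitz_onI)
    fix x y
    show "dist (k x) (k y) \<le> 1 * dist x y"
      using exp[of "k x" "k y"] exp[of "k y" "k x"] by (auto simp: dist_real_def abs_if)
  qed simp
  then have k_meas [measurable]: "k \<in> borel_measurable borel"
    by (intro borel_measurable_continuous_onI lipschitz_on_continuous_on)
  define \<mu> where "\<mu> = distr lborel borel k"
  have "absolutely_continuous lborel \<mu>"
    unfolding absolutely_continuous_def
  proof
    fix A :: "real set" assume A: "A \<in> null_sets lborel"
    then have "negligible A"
      by (simp add: negligible_iff_null_sets null_sets_completionI)
    then have "negligible (G ` A)"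
    proof (rule negligible_locally_Lipschitz_image[rotated])
      fix x assume "x \<in> A"
      show "\<exists>T B. open T \<and> x \<in> T \<and> (\<forall>y\<in>A \<inter> T. norm (G y - G x) \<le> B * norm (y - x))"
        using lipschitz_onD[OF lip] by (intro exI[of _ UNIV] exI[of _ K]) (auto simp: dist_norm)
    qed auto
    moreover have [measurable]: "A \<in> sets borel" using A by auto
    moreover have "k -` A \<inter> space lborel \<in> sets lborel" by measurable
    ultimately show "A \<in> null_sets \<mu>"
      by (simp add: null_sets_def \<mu>_def emeasure_distr vimage negligible_iff_null_sets)
  qed
  moreover have "sets \<mu> = sets lborel" by (simp add: \<mu>_def)
  ultimately obtain h where h_meas [measurable]: "h \<in> borel_measurable lborel"
    and h: "density lborel h = \<mu>"
    using sigma_finite_measure.Radon_Nikodym[OF sigma_finite_lborel] by blast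
  have int_h: "(\<integral>\<^sup>+x. h x * indicator {a..b} x \<partial>lborel) = ennreal (G b - G a)" if "a \<le> b" for a b
  proof -
    have "G ` {a..b} = {G a..G b}"
    proof
      show "G ` {a..b} \<subseteq> {G a..G b}"
        using strict_mono_mono[OF mono] by (auto simp: mono_def)
      show "{G a..G b} \<subseteq> G ` {a..b}"
      proof
        fix z assume "z \<in> {G a..G b}"
        then have "k z \<in> {a..b}"
          using strict_mono_less_eq[OF mono, of a "k z"] strict_mono_less_eq[OF mono, of "k z" b] by auto
        then show "z \<in> G ` {a..b}" by (metis Gk imageI)
      qed
    qed
    then have "emeasure \<mu> {a..b} = ennreal (G b - G a)"
      using that exp[of a b] by (simp add: \<mu>_def emeasure_distr vimage)
    moreover have "emeasure \<mu> {a..b} = (\<integral>\<^sup>+x. h x * indicator {a..b} x \<partial>lborel)"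
      by (simp flip: h add: emeasure_density)
    ultimately show ?thesis by simp
  qed
  have integral_h: "((\<lambda>x. enn2real (h x)) has_integral (G b - G a)) {a..b}" if "a \<le> b" for a b
  proof -
    \<comment> \<open>The density takes extended values; its finite integral over
      \<open>{a..b}\<close> makes it finite at almost every point there, so \<open>enn2real\<close>
      changes it only on a null set.\<close>
    have "AE x in lborel. h x * indicator {a..b} x \<noteq> \<infinity>"
      using int_h[OF that] by (intro nn_integral_PInf_AE) auto
    then have "AE x in lborel. ennreal (enn2real (h x) * indicator {a..b} x) = h x * indicator {a..b} x"
      by eventually_elim (auto simp: indicator_def less_top split: if_splits)
    then have "(\<integral>\<^sup>+x. ennreal (enn2real (h x) * indicator {a..b} x) \<partial>lborel) = ennreal (G b - G a)"
      using int_h[OF that] by (subst nn_integral_cong_AE) auto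
    then have "has_bochner_integral lborel (\<lambda>x. enn2real (h x) * indicator {a..b} x) (G b - G a)"
      using exp[OF that] that by (intro has_bochner_integral_nn_integral) auto
    then have "((\<lambda>x. enn2real (h x) * indicator {a..b} x) has_integral (G b - G a)) UNIV"
      using has_integral_integral_lborel by (metis has_bochner_integral_iff)
    moreover have "(\<lambda>x. enn2real (h x) * indicator {a..b} x) = (\<lambda>x. if x \<in> {a..b} then enn2real (h x) else 0)"
      by (auto simp: indicator_def)
    ultimately show ?thesis
      by (simp only: has_integral_restrict_UNIV)
  qed
  have "(\<lambda>x. enn2real (h x)) integrable_on cbox a b" for a b
    using integral_h[of a b] by (cases "a \<le> b") auto
  \<comment> \<open>Lebesgue differentiation over cubes with lower corner \<open>x\<close>. In
    dimension one the cube is \<open>[x, x + r]\<close>, whose average is a right difference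
    quotient of \<open>G\<close>.\<close>
  from integrable_ccontinuous_explicit[OF this] obtain N where N: "negligible N"
    and lim: "\<And>x e. x \<notin> N \<Longrightarrow> 0 < e \<Longrightarrow> \<exists>d>0. \<forall>r. 0 < r \<and> r < d \<longrightarrow>
      norm (integral (cbox x (x + r *\<^sub>R One)) (\<lambda>x. enn2real (h x)) /\<^sub>R r ^ DIM(real) - enn2real (h x)) < e"
    by metis
  have "((\<lambda>r. (G (x + r) - G x) / r) \<longlongrightarrow> enn2real (h x)) (at_right 0)" if "x \<notin> N" for x
  proof (rule tendstoI)
    fix e :: real assume "e > 0"
    from lim[OF that this] obtain d where "d > 0" and
      d: "\<And>r. 0 < r \<Longrightarrow> r < d \<Longrightarrow> \<bar>integral {x..x + r} (\<lambda>x. enn2real (h x)) / r - enn2real (h x)\<bar> < e"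
      by (auto simp: divide_inverse mult.commute)
    have "dist ((G (x + r) - G x) / r) (enn2real (h x)) < e" if "0 < r" "r < d" for r
      using d[OF that] integral_unique[OF integral_h[of x "x + r"]] that by (simp add: dist_real_def)
    then show "\<forall>\<^sub>F r in at_right 0. dist ((G (x + r) - G x) / r) (enn2real (h x)) < e"
      using \<open>d > 0\<close> by (auto simp: eventually_at_right_field)
  qed
  with negligible_imp_AE_lborel[OF N] show ?thesis
    by (auto elim: eventually_mono)
qed

text \<open>Adding \<open>(L + 1) * x\<close> outweighs the steepest possible descent of
  \<open>f\<close> and leaves slope at least 1, which reduces to the expansive case; the linear term
  only shifts the derivative by \<open>L + 1\<close>.\<close>

lemma lipschitz_right_derivative_exists_AE:
  fixes f :: "real \<Rightarrow> real"
  assumes lip: "L-lipschitz_on UNIV f"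
  shows "AE x in lborel. \<exists>l. ((\<lambda>h. (f (x + h) - f x) / h) \<longlongrightarrow> l) (at_right 0)"
proof -
  define G where "G x = f x + (L + 1) * x" for x
  have f_lip: "\<bar>f x - f y\<bar> \<le> L * \<bar>x - y\<bar>" for x y
    using lipschitz_onD[OF lip, of x y] by (simp add: dist_real_def)
  then have exp: "y - x \<le> G y - G x" if "x \<le> y" for x y
  proof -
    have "\<bar>f x - f y\<bar> \<le> L * (y - x)"
      using f_lip[of x y] that by (simp add: abs_minus_commute)
    then have "f x - f y \<le> L * (y - x)" by linarith
    then show ?thesis by (simp add: G_def algebra_simps)
  qed
  have "(L + \<bar>L + 1\<bar> * 1)-lipschitz_on UNIV G"
    unfolding G_def using lip by (intro lipschitz_on_add lipschitz_on_cmult_real lipschitz_on_id)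
  from right_derivative_exists_AE_of_expansive[OF this exp]
  have "AE x in lborel. \<exists>l. ((\<lambda>h. (G (x + h) - G x) / h) \<longlongrightarrow> l) (at_right 0)" .
  then show ?thesis
  proof eventually_elim
    case (elim x)
    then obtain l where "((\<lambda>h. (G (x + h) - G x) / h) \<longlongrightarrow> l) (at_right 0)" by auto
    then have "((\<lambda>h. (G (x + h) - G x) / h - (L + 1)) \<longlongrightarrow> l - (L + 1)) (at_right 0)"
      by (intro tendsto_intros)
    moreover have "\<forall>\<^sub>F h in at_right 0. (G (x + h) - G x) / h - (L + 1) = (f (x + h) - f x) / h"
      by (rule eventually_at_rightI[of 0 1]) (auto simp: G_def field_simps)
    ultimately show ?case
      by (intro exI) (rule Lim_transform_eventually)
  qed
qed

section \<open>Rademacher's theorem\<close>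

text \<open>For Lipschitz functions the increments \<open>1 / Suc n\<close> suffice to detect differentiability,
  so that all limits below are limits of sequences of Borel functions.\<close>

definition diff_quot :: "('a::real_vector \<Rightarrow> real) \<Rightarrow> 'a \<Rightarrow> nat \<Rightarrow> 'a \<Rightarrow> real" where
  "diff_quot f v n x = real (Suc n) * (f (x + v /\<^sub>R real (Suc n)) - f x)"

text \<open>Tonelli on \<open>[0,1] \<times> 'a\<close>: each translate \<open>E - t v\<close> has the measure of \<open>E\<close>, so no change of
  coordinates aligning \<open>v\<close> with an axis is needed.\<close>

lemma AE_lborel_of_AE_lines:
  fixes E :: "'a::euclidean_space set"
  assumes [measurable]: "E \<in> sets borel"
    and lines: "\<And>x. AE t in lborel. x + t *\<^sub>R v \<notin> E"
  shows "AE x in lborel. x \<notin> E"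
proof -
  let ?F = "\<lambda>(t::real) x. indicator {0..1} t * indicator E (x + t *\<^sub>R v) :: ennreal"
  have transl: "(\<integral>\<^sup>+x. indicator E (x + t *\<^sub>R v) \<partial>lborel) = emeasure lborel E" for t
  proof -
    have "emeasure lborel E = (\<integral>\<^sup>+x. indicator E x \<partial>distr lborel borel ((+) (t *\<^sub>R v)))"
      by (simp add: lborel_distr_plus)
    also have "\<dots> = (\<integral>\<^sup>+x. indicator E (x + t *\<^sub>R v) \<partial>lborel)"
      by (subst nn_integral_distr) (auto simp: add.commute)
    finally show ?thesis by simp
  qed
  have "emeasure lborel E = (\<integral>\<^sup>+t. indicator {0..1::real} t * emeasure lborel E \<partial>lborel)"
    by (simp add: nn_integral_multc)
  also have "\<dots> = (\<integral>\<^sup>+t. (\<integral>\<^sup>+x. ?F t x \<partial>lborel) \<partial>lborel)"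
    by (simp add: nn_integral_cmult transl)
  also have "\<dots> = (\<integral>\<^sup>+x. (\<integral>\<^sup>+t. ?F t x \<partial>lborel) \<partial>lborel)"
    by (subst lborel_pair.Fubini') auto
  also have "\<dots> = (\<integral>\<^sup>+x. 0 \<partial>(lborel :: 'a measure))"
  proof (intro nn_integral_cong)
    fix x
    have "(\<integral>\<^sup>+t. ?F t x \<partial>lborel) = (\<integral>\<^sup>+(t::real). 0 \<partial>lborel)"
      using lines[of x] by (intro nn_integral_cong_AE) (auto elim!: eventually_mono)
    then show "(\<integral>\<^sup>+t. ?F t x \<partial>lborel) = 0" by simp
  qed
  finally have "E \<in> null_sets lborel"
    by (intro null_setsI) auto
  then show ?thesis by (rule AE_not_in)
qed

text \<open>By Lebesgue differentiation, \<open>f x\<close> is for almost every \<open>x\<close> the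
  limit of averages over shrinking cubes at \<open>x\<close>, and all these averages are 0.\<close>

lemma AE_eq_0_of_cbox_integrals:
  fixes f :: "'a::euclidean_space \<Rightarrow> real"
  assumes int: "\<And>a b. (f has_integral 0) (cbox a b)"
  shows "AE x in lborel. f x = 0"
proof -
  have "f integrable_on cbox a b" for a b using int by blast
  from integrable_ccontinuous_explicit[OF this] obtain N where N: "negligible N"
    and lim: "\<And>x e. x \<notin> N \<Longrightarrow> 0 < e \<Longrightarrow> \<exists>d>0. \<forall>r. 0 < r \<and> r < d \<longrightarrow>
      norm (integral (cbox x (x + r *\<^sub>R One)) f /\<^sub>R r ^ DIM('a) - f x) < e"
    by metis
  have "f x = 0" if x: "x \<notin> N" for x
  proof (rule ccontr)
    assume "f x \<noteq> 0"
    then have "\<exists>d>0. \<forall>r>0. \<not> r < (d::real)"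
      using lim[OF x, of "\<bar>f x\<bar>"] integral_unique[OF int] by simp
    then show False by (meson dense)
  qed
  with negligible_imp_AE_lborel[OF N] show ?thesis
    by (auto elim: eventually_mono)
qed

text \<open>Dominated convergence. The shifts are bounded, so all integrands live in one ball and
  are dominated by a multiple of its indicator. The shifted indicators converge off the frontier of
  the box, which is negligible.\<close>

lemma tendsto_integral_indicator_translate:
  fixes X :: "nat \<Rightarrow> 'a::euclidean_space \<Rightarrow> real"
  assumes X [measurable]: "\<And>n. X n \<in> borel_measurable borel"
    and D [measurable]: "D \<in> borel_measurable borel"
    and bound: "\<And>n x. \<bar>X n x\<bar> \<le> C"
    and lim: "AE x in lborel. (\<lambda>n. X n x) \<longlonglongrightarrow> D x"
    and s: "s \<longlonglongrightarrow> 0"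
  shows "integrable lborel (\<lambda>x. indicator (cbox a b) (x + s n) * X n x)"
    and "integrable lborel (\<lambda>x. indicator (cbox a b) x * D x)"
    and "(\<lambda>n. \<integral>x. indicator (cbox a b) (x + s n) * X n x \<partial>lborel) \<longlonglongrightarrow>
      (\<integral>x. indicator (cbox a b) x * D x \<partial>lborel)"
proof -
  let ?B = "cbox a b"
  obtain R where R: "\<And>n. norm (s n) \<le> R"
    using convergent_imp_Bseq[OF convergentI[OF s]] by (auto simp: Bseq_def)
  obtain M where M: "\<And>x. x \<in> ?B \<Longrightarrow> norm x \<le> M"
    using bounded_cbox[of a b] by (auto simp: bounded_iff)
  define w :: "'a \<Rightarrow> real" where "w x = C * indicator (cball 0 (M + R)) x" for x
  have "integrable lborel (indicator (cball 0 (M + R)) :: 'a \<Rightarrow> real)"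
    by (subst integrable_indicator_iff) (use emeasure_bounded_finite[OF bounded_cball] in auto)
  then have w: "integrable lborel w"
    unfolding w_def by (intro integrable_mult_right)
  have C: "0 \<le> C" using bound[of 0 undefined] by linarith
  have wb: "norm (indicator ?B (x + s n) * X n x) \<le> w x" for n x
  proof (cases "x + s n \<in> ?B")
    case True
    have "norm x \<le> norm (x + s n) + norm (s n)"
      using norm_triangle_ineq4[of "x + s n" "s n"] by simp
    with M[OF True] R[of n] have "norm x \<le> M + R" by linarith
    then show ?thesis using bound[of n x] True by (simp add: w_def)
  next
    case False
    then show ?thesis using C by (simp add: w_def)
  qed
  show "integrable lborel (\<lambda>x. indicator ?B (x + s n) * X n x)"
    by (rule Bochner_Integration.integrable_bound[OF w])
      (use wb in \<open>auto intro!: AE_I2 intro: order_trans[OF _ abs_ge_self]\<close>)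
  have "negligible (frontier ?B)"
    by (simp add: negligible_convex_frontier)
  then have "AE x in lborel. x \<notin> frontier ?B"
    by (rule negligible_imp_AE_lborel)
  with lim have conv: "AE x in lborel. (\<lambda>n. indicator ?B (x + s n) * X n x) \<longlonglongrightarrow> indicator ?B x * D x"
  proof eventually_elim
    case (elim x)
    have xs: "(\<lambda>n. x + s n) \<longlonglongrightarrow> x"
      using tendsto_add[OF tendsto_const s, of x] by simp
    have "(\<lambda>n. indicator ?B (x + s n)) \<longlonglongrightarrow> (indicator ?B x :: real)"
    proof (cases "x \<in> ?B")
      case True
      with elim have "x \<in> interior ?B" by (simp add: frontier_def)
      from topological_tendstoD[OF xs open_interior this]
      have "\<forall>\<^sub>F n in sequentially. x + s n \<in> ?B"
        by eventually_elim (use interior_subset in blast)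
      then have "\<forall>\<^sub>F n in sequentially. indicator ?B (x + s n) = (indicator ?B x :: real)"
        by eventually_elim (use True in simp)
      then show ?thesis by (rule tendsto_eventually)
    next
      case False
      from topological_tendstoD[OF xs, of "- ?B"] False
      have "\<forall>\<^sub>F n in sequentially. x + s n \<in> - ?B"
        by (auto simp: open_Compl closed_cbox)
      then have "\<forall>\<^sub>F n in sequentially. indicator ?B (x + s n) = (indicator ?B x :: real)"
        by eventually_elim (use False in simp)
      then show ?thesis by (rule tendsto_eventually)
    qed
    with elim show ?case by (intro tendsto_mult) auto
  qed
  show "integrable lborel (\<lambda>x. indicator ?B x * D x)"
    by (rule integrable_dominated_convergence[OF _ _ w conv]) (use wb in auto)
  show "(\<lambda>n. \<integral>x. indicator ?B (x + s n) * X n x \<partial>lborel) \<longlonglongrightarrow> (\<integral>x. indicator ?B x * D x \<partial>lborel)"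
    by (rule integral_dominated_convergence[OF _ _ w conv]) (use wb in auto)
qed

section \<open>Directional derivatives of a Lipschitz function: existence and additivity almost
  everywhere\<close>

context
  fixes f :: "'a::euclidean_space \<Rightarrow> real" and L :: real
  assumes lip: "L-lipschitz_on UNIV f"
begin

lemma diff_quot_measurable [measurable]: "diff_quot f v n \<in> borel_measurable borel"
proof -
  have [measurable]: "f \<in> borel_measurable borel"
    using lip by (intro borel_measurable_continuous_onI lipschitz_on_continuous_on)
  show ?thesis unfolding diff_quot_def by measurable
qed

text \<open>The bound is uniform in \<open>n\<close> and \<open>x\<close>: it dominates the
  quotients under the integral and later carries convergence from rational directions to all
  directions.\<close>

lemma abs_diff_quot_diff_le: "\<bar>diff_quot f v n x - diff_quot f w n x\<bar> \<le> L * norm (v - w)"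
proof -
  have "\<bar>f (x + v /\<^sub>R real (Suc n)) - f (x + w /\<^sub>R real (Suc n))\<bar>
      \<le> L * norm ((v - w) /\<^sub>R real (Suc n))"
    using lipschitz_onD[OF lip, of "x + v /\<^sub>R real (Suc n)" "x + w /\<^sub>R real (Suc n)"]
    by (simp add: dist_norm real_vector.scale_right_diff_distrib)
  then have "real (Suc n) * \<bar>f (x + v /\<^sub>R real (Suc n)) - f (x + w /\<^sub>R real (Suc n))\<bar>
      \<le> real (Suc n) * (L * norm ((v - w) /\<^sub>R real (Suc n)))"
    by (intro mult_left_mono) auto
  also have "\<dots> = L * norm (v - w)" by simp
  also have "real (Suc n) * \<bar>f (x + v /\<^sub>R real (Suc n)) - f (x + w /\<^sub>R real (Suc n))\<bar> =
      \<bar>real (Suc n) * (f (x + v /\<^sub>R real (Suc n)) - f (x + w /\<^sub>R real (Suc n)))\<bar>"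
    by (simp add: abs_mult)
  also have "real (Suc n) * (f (x + v /\<^sub>R real (Suc n)) - f (x + w /\<^sub>R real (Suc n))) =
      diff_quot f v n x - diff_quot f w n x"
    by (simp add: diff_quot_def algebra_simps)
  finally show ?thesis .
qed

lemma abs_diff_quot_le: "\<bar>diff_quot f v n x\<bar> \<le> L * norm v"
  using abs_diff_quot_diff_le[of v n x 0] by (simp add: diff_quot_def)

text \<open>Along each line parallel to \<open>v\<close> the function is Lipschitz in one variable,
  so bad points are null on every such line. Stating failure through \<open>Cauchy\<close> makes the
  bad set Borel, and Tonelli then shows that it is null.\<close>

lemma diff_quot_convergent_AE: "AE x in lborel. convergent (\<lambda>n. diff_quot f v n x)"
proof -
  define E where "E = {x \<in> space borel. \<not> Cauchy (\<lambda>n. diff_quot f v n x)}"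
  have "E \<in> sets borel" unfolding E_def by measurable
  moreover have "AE t in lborel. x + t *\<^sub>R v \<notin> E" for x
  proof -
    define \<phi> where "\<phi> t = f (x + t *\<^sub>R v)" for t
    have "(L * norm v)-lipschitz_on UNIV \<phi>"
    proof (rule lipschitz_onI)
      show "dist (\<phi> t) (\<phi> u) \<le> L * norm v * dist t u" for t u
        using lipschitz_onD[OF lip, of "x + t *\<^sub>R v" "x + u *\<^sub>R v"]
        by (simp add: \<phi>_def dist_norm ac_simps flip: scaleR_diff_left)
    qed (use lipschitz_on_nonneg[OF lip] in simp)
    from lipschitz_right_derivative_exists_AE[OF this] show ?thesis
    proof eventually_elim
      case (elim t)
      then obtain l where "((\<lambda>h. (\<phi> (t + h) - \<phi> t) / h) \<longlongrightarrow> l) (at_right 0)" by auto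
      \<comment> \<open>The increments \<open>1 / Suc n\<close> are positive, so a one-sided
        derivative suffices.\<close>
      moreover have "filterlim (\<lambda>n. inverse (real (Suc n))) (at_right 0) sequentially"
        using LIMSEQ_inverse_real_of_nat
        by (auto simp: filterlim_at intro!: always_eventually)
      ultimately have "(\<lambda>n. (\<phi> (t + inverse (real (Suc n))) - \<phi> t) / inverse (real (Suc n))) \<longlonglongrightarrow> l"
        by (rule filterlim_compose)
      also have "(\<lambda>n. (\<phi> (t + inverse (real (Suc n))) - \<phi> t) / inverse (real (Suc n))) =
          (\<lambda>n. diff_quot f v n (x + t *\<^sub>R v))"
        by (simp add: \<phi>_def diff_quot_def scaleR_add_left add.assoc divide_inverse mult.commute fun_eq_iff)
      finally show ?case
        by (auto simp: E_def intro: LIMSEQ_imp_Cauchy)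
    qed
  qed
  ultimately have "AE x in lborel. x \<notin> E" by (rule AE_lborel_of_AE_lines)
  then show ?thesis
    by eventually_elim (simp add: E_def Cauchy_convergent)
qed

lemma lim_diff_quot_measurable [measurable]:
  "(\<lambda>x. lim (\<lambda>n. diff_quot f v n x)) \<in> borel_measurable borel"
  by measurable

lemma diff_quot_tendsto_lim_AE:
  "AE x in lborel. (\<lambda>n. diff_quot f v n x) \<longlonglongrightarrow> lim (\<lambda>n. diff_quot f v n x)"
  using diff_quot_convergent_AE by eventually_elim (simp add: convergent_LIMSEQ_iff)

text \<open>The quotient in direction \<open>v + w\<close> splits into the one along \<open>v\<close> at \<open>x\<close> and the one along
  \<open>w\<close> at the shifted point \<open>x + v / Suc n\<close>; after integration over a box the shift moves to the
  indicator of the box and disappears in the limit.\<close>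

lemma lim_diff_quot_add_AE:
  "AE x in lborel. lim (\<lambda>n. diff_quot f (v + w) n x) =
     lim (\<lambda>n. diff_quot f v n x) + lim (\<lambda>n. diff_quot f w n x)"
proof -
  let ?D = "\<lambda>v x. lim (\<lambda>n. diff_quot f v n x)"
  define s where "s n = v /\<^sub>R real (Suc n)" for n
  have s: "(\<lambda>n. - s n) \<longlonglongrightarrow> 0"
    using tendsto_minus[OF tendsto_scaleR[OF LIMSEQ_inverse_real_of_nat tendsto_const[of v]]]
    by (simp add: s_def)
  note T = tendsto_integral_indicator_translate[OF diff_quot_measurable lim_diff_quot_measurable
      abs_diff_quot_le diff_quot_tendsto_lim_AE]
  have T1: "integrable lborel (\<lambda>x. indicator (cbox a b) (x + r n) * diff_quot f u n x)"
    and T2: "integrable lborel (\<lambda>x. indicator (cbox a b) x * ?D u x)"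
    and T3: "(\<lambda>n. \<integral>x. indicator (cbox a b) (x + r n) * diff_quot f u n x \<partial>lborel) \<longlonglongrightarrow>
      (\<integral>x. indicator (cbox a b) x * ?D u x \<partial>lborel)"
    if "r \<longlonglongrightarrow> 0" for r a b u n
    using T[OF that] by blast+
  have "((\<lambda>x. ?D (v + w) x - (?D v x + ?D w x)) has_integral 0) (cbox a b)" for a b
  proof -
    let ?I = "indicator (cbox a b) :: 'a \<Rightarrow> real"
    have split: "(\<integral>x. ?I x * diff_quot f (v + w) n x \<partial>lborel) =
        (\<integral>x. ?I x * diff_quot f v n x \<partial>lborel) + (\<integral>x. ?I (x + - s n) * diff_quot f w n x \<partial>lborel)" for n
    proof -
      have "diff_quot f (v + w) n x = diff_quot f v n x + diff_quot f w n (s n + x)" for x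
        by (simp add: diff_quot_def s_def algebra_simps)
      then have "(\<integral>x. ?I x * diff_quot f (v + w) n x \<partial>lborel) =
          (\<integral>x. ?I x * diff_quot f v n x + ?I ((s n + x) + - s n) * diff_quot f w n (s n + x) \<partial>lborel)"
        by (simp add: distrib_left)
      also have "\<dots> = (\<integral>x. ?I x * diff_quot f v n x \<partial>lborel) +
          (\<integral>x. ?I ((s n + x) + - s n) * diff_quot f w n (s n + x) \<partial>lborel)"
      proof (rule Bochner_Integration.integral_add)
        show "integrable lborel (\<lambda>x. ?I x * diff_quot f v n x)"
          using T1[of "\<lambda>_. 0" a b n v] by simp
        \<comment> \<open>Lebesgue measure is its own image under the translation by
          \<open>s n\<close>, so integrability can be read on the image measure and pulled back to
          the shifted integrand.\<close>
        have "integrable (distr lborel borel ((+) (s n))) (\<lambda>x. ?I (x + - s n) * diff_quot f w n x)"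
          using T1[OF s, of a b n w] by (simp add: lborel_distr_plus)
        then show "integrable lborel (\<lambda>x. ?I ((s n + x) + - s n) * diff_quot f w n (s n + x))"
          by (subst (asm) integrable_distr_eq) auto
      qed
      also have "(\<integral>x. ?I ((s n + x) + - s n) * diff_quot f w n (s n + x) \<partial>lborel) =
          (\<integral>x. ?I (x + - s n) * diff_quot f w n x \<partial>distr lborel borel ((+) (s n)))"
        by (subst integral_distr) auto
      finally show ?thesis by (simp add: lborel_distr_plus)
    qed
    have "(\<lambda>n. \<integral>x. ?I x * diff_quot f (v + w) n x \<partial>lborel) \<longlonglongrightarrow> (\<integral>x. ?I x * ?D (v + w) x \<partial>lborel)"
      using T3[of "\<lambda>_. 0" a b "v + w"] by simp
    moreover have "(\<lambda>n. \<integral>x. ?I x * diff_quot f (v + w) n x \<partial>lborel) \<longlonglongrightarrow>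
        (\<integral>x. ?I x * ?D v x \<partial>lborel) + (\<integral>x. ?I x * ?D w x \<partial>lborel)"
      unfolding split using T3[of "\<lambda>_. 0" a b v] T3[OF s, of a b w] by (intro tendsto_add) auto
    ultimately have eq: "(\<integral>x. ?I x * ?D (v + w) x \<partial>lborel) =
        (\<integral>x. ?I x * ?D v x \<partial>lborel) + (\<integral>x. ?I x * ?D w x \<partial>lborel)"
      by (rule LIMSEQ_unique)
    have int: "integrable lborel (\<lambda>x. ?I x * ?D u x)" for u
      using T2[of "\<lambda>_. 0" a b u] by simp
    have "((\<lambda>x. ?I x * ?D (v + w) x - (?I x * ?D v x + ?I x * ?D w x)) has_integral 0) UNIV"
      using has_integral_integral_lborel[of "\<lambda>x. ?I x * ?D (v + w) x - (?I x * ?D v x + ?I x * ?D w x)"]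
        int by (simp add: eq)
    moreover have "(\<lambda>x. ?I x * ?D (v + w) x - (?I x * ?D v x + ?I x * ?D w x)) =
        (\<lambda>x. if x \<in> cbox a b then ?D (v + w) x - (?D v x + ?D w x) else 0)"
      by (auto simp: indicator_def)
    ultimately show ?thesis
      by (simp only: has_integral_restrict_UNIV)
  qed
  from AE_eq_0_of_cbox_integrals[OF this] show ?thesis
    by eventually_elim simp
qed

end

section \<open>From rational directions to the full derivative\<close>

definition rational_vectors :: "'a::euclidean_space set" where
  "rational_vectors = {q. \<forall>i\<in>Basis. q \<bullet> i \<in> \<rat>}"

text \<open>Countability lets the exceptional null sets of all rational directions, and of all pairs
  of them, be united into one null set.\<close>

lemma countable_rational_vectors: "countable rational_vectors"
proof -
  have "rational_vectors \<subseteq> (\<lambda>c. \<Sum>i\<in>Basis. c i *\<^sub>R i) ` (PiE (Basis :: 'a set) (\<lambda>_. \<rat> :: real set))"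
  proof
    fix q :: 'a assume q: "q \<in> rational_vectors"
    show "q \<in> (\<lambda>c. \<Sum>i\<in>Basis. c i *\<^sub>R i) ` (PiE Basis (\<lambda>_. \<rat>))"
    proof (rule image_eqI)
      show "q = (\<Sum>i\<in>Basis. restrict ((\<bullet>) q) Basis i *\<^sub>R i)"
        by (simp add: euclidean_representation)
      show "restrict ((\<bullet>) q) Basis \<in> PiE Basis (\<lambda>_. \<rat>)"
        using q by (auto simp: rational_vectors_def)
    qed
  qed
  moreover have "countable (PiE (Basis :: 'a set) (\<lambda>_. \<rat> :: real set))"
    by (intro countable_PiE countable_rat finite_Basis)
  ultimately show ?thesis
    by (meson countable_image countable_subset)
qed

lemma rational_vectors_dense:
  fixes x :: "'a::euclidean_space"
  assumes "e > 0"
  obtains q where "q \<in> rational_vectors" "dist q x < e"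
proof -
  obtain a b where ab: "\<forall>i\<in>Basis. a \<bullet> i \<in> \<rat> \<and> b \<bullet> i \<in> \<rat>" "x \<in> box a b" "box a b \<subseteq> ball x e"
    using rational_boxes[OF assms, of x] by auto
  have "box a b \<noteq> {}" using \<open>x \<in> box a b\<close> by auto
  \<comment> \<open>The center of a box with rational corners is itself rational.\<close>
  define q where "q = (1/2) *\<^sub>R (a + b)"
  have "\<forall>i\<in>Basis. a \<bullet> i < b \<bullet> i"
    using \<open>box a b \<noteq> {}\<close> by (simp add: box_ne_empty)
  then have "q \<in> box a b"
    by (auto simp: q_def mem_box inner_add_left field_simps)
  then have "dist q x < e"
    using \<open>box a b \<subseteq> ball x e\<close> by (auto simp: dist_commute)
  moreover have "q \<in> rational_vectors"
    using ab by (auto simp: rational_vectors_def q_def inner_add_left)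
  ultimately show ?thesis by (rule that[rotated])
qed

text \<open>Additivity forces homogeneity, successively for natural, negative, integer and rational
  factors; expanding \<open>q\<close> in the basis uses only rational coefficients. The vector on
  the right is the candidate gradient.\<close>

lemma additive_on_rational_vectors:
  fixes D :: "'a::euclidean_space \<Rightarrow> real"
  assumes add: "\<And>v w. v \<in> rational_vectors \<Longrightarrow> w \<in> rational_vectors \<Longrightarrow> D (v + w) = D v + D w"
    and q: "q \<in> rational_vectors"
  shows "D q = q \<bullet> (\<Sum>i\<in>Basis. D i *\<^sub>R i)"
proof -
  have scale_in: "r *\<^sub>R v \<in> rational_vectors" if "r \<in> \<rat>" "v \<in> rational_vectors" for r and v :: 'a
    using that by (auto simp: rational_vectors_def)
  have zero_in: "0 \<in> (rational_vectors :: 'a set)" by (simp add: rational_vectors_def)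
  have D0: "D 0 = 0" using add[OF zero_in zero_in] by simp
  have D_nat: "D (real m *\<^sub>R v) = real m * D v" if v: "v \<in> rational_vectors" for m v
  proof (induction m)
    case (Suc m)
    have "real m *\<^sub>R v \<in> rational_vectors" using v by (intro scale_in) auto
    from add[OF v this] Suc show ?case by (simp add: algebra_simps)
  qed (simp add: D0)
  have D_minus: "D (- v) = - D v" if v: "v \<in> rational_vectors" for v
  proof -
    have "- v \<in> rational_vectors" using v by (auto simp: rational_vectors_def)
    from add[OF v this] show ?thesis by (simp add: D0)
  qed
  have D_int: "D (real_of_int k *\<^sub>R v) = real_of_int k * D v" if v: "v \<in> rational_vectors" for k v
  proof (cases k)
    case (nonneg n)
    then show ?thesis using D_nat[OF v, of n] by simp
  next
    case (neg n)
    have "real (Suc n) *\<^sub>R v \<in> rational_vectors" using v by (intro scale_in) auto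
    moreover have "real_of_int k = - real (Suc n)" using neg by simp
    ultimately show ?thesis
      by (simp only: scaleR_minus_left D_minus D_nat[OF v] mult_minus_left)
  qed
  have D_rat: "D (r *\<^sub>R v) = r * D v" if v: "v \<in> rational_vectors" and r: "r \<in> \<rat>" for r v
  proof -
    obtain k and m :: int where m: "m > 0" and r_eq: "r = real_of_int k / real_of_int m"
      using r by (rule Rats_cases')
    have "real_of_int m * D (r *\<^sub>R v) = D (real_of_int m *\<^sub>R (r *\<^sub>R v))"
      using scale_in[OF r v] by (simp only: D_int)
    also have "real_of_int m *\<^sub>R (r *\<^sub>R v) = real_of_int k *\<^sub>R v"
      using m by (simp add: r_eq)
    finally show ?thesis using m D_int[OF v] by (simp add: r_eq field_simps)
  qed
  have basis_in: "i \<in> rational_vectors" if "i \<in> Basis" for i :: 'a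
    using that by (auto simp: rational_vectors_def inner_Basis)
  \<comment> \<open>The induction also carries membership of the partial sums, because additivity is
    available only between rational vectors.\<close>
  have "(\<Sum>i\<in>S. (q \<bullet> i) *\<^sub>R i) \<in> rational_vectors \<and>
      D (\<Sum>i\<in>S. (q \<bullet> i) *\<^sub>R i) = (\<Sum>i\<in>S. (q \<bullet> i) * D i)" if "finite S" "S \<subseteq> Basis" for S
    using that
  proof (induction S rule: finite_induct)
    case empty
    then show ?case by (simp add: D0 zero_in)
  next
    case (insert i S)
    have qi: "q \<bullet> i \<in> \<rat>" and i: "i \<in> rational_vectors"
      using q insert basis_in by (auto simp: rational_vectors_def)
    have "(q \<bullet> i) *\<^sub>R i \<in> rational_vectors" using qi i by (rule scale_in)
    with insert add[of "(q \<bullet> i) *\<^sub>R i" "\<Sum>i\<in>S. (q \<bullet> i) *\<^sub>R i"] show ?case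
      by (auto simp: D_rat[OF i qi] rational_vectors_def inner_add_left)
  qed
  from this[OF finite_Basis subset_refl] show ?thesis
    by (simp add: euclidean_representation inner_sum_right mult.commute)
qed

text \<open>By compactness, finitely many rational directions come within \<epsilon> of every vector
  in the unit ball. Convergence is uniform over this finite set, and the Lipschitz bound in the
  direction extends it to the whole ball.\<close>

lemma lipschitz_has_derivative_of_rational_directions:
  fixes f :: "'a::euclidean_space \<Rightarrow> real"
  assumes lip: "L-lipschitz_on UNIV f"
    and dir: "\<And>q. q \<in> rational_vectors \<Longrightarrow> (\<lambda>n. diff_quot f q n x) \<longlonglongrightarrow> q \<bullet> l"
  shows "(f has_derivative (\<lambda>u. u \<bullet> l)) (at x)"
  unfolding has_derivative_at_alt
proof (intro conjI allI impI)
  show "bounded_linear (\<lambda>u. u \<bullet> l)" by (rule bounded_linear_inner_left)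
next
  fix e :: real assume "e > 0"
  have "0 \<le> L" using lip by (rule lipschitz_on_nonneg)
  \<comment> \<open>Three errors add up to \<open>c * \<epsilon>\<close>:
    \<open>L * \<epsilon>\<close> for replacing the direction in the quotient, \<epsilon> for
    convergence, \<open>norm l * \<epsilon>\<close> for replacing it in the linear map. The total is
    \<open>e / 2\<close> because the rescaled step below has norm only at least
    \<open>1/2\<close>.\<close>
  define c where "c = L + norm l + 1"
  define \<epsilon> where "\<epsilon> = e / (2 * c)"
  have "0 < c"
    using \<open>0 \<le> L\<close> norm_ge_zero[of l] unfolding c_def by linarith
  then have eps: "\<epsilon> > 0" "c * \<epsilon> = e / 2"
    using \<open>e > 0\<close> by (simp_all add: \<epsilon>_def)
  have "cball (0::'a) 1 \<subseteq> (\<Union>q\<in>rational_vectors. ball q \<epsilon>)"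
  proof
    fix z :: 'a
    obtain q where "q \<in> rational_vectors" "dist q z < \<epsilon>"
      using rational_vectors_dense[OF eps(1)] .
    then show "z \<in> (\<Union>q\<in>rational_vectors. ball q \<epsilon>)" by auto
  qed
  from compactE_image[OF compact_cball open_ball this]
  obtain F where F: "F \<subseteq> rational_vectors" "finite F" "cball (0::'a) 1 \<subseteq> (\<Union>q\<in>F. ball q \<epsilon>)"
    by metis
  have "\<forall>\<^sub>F n in sequentially. \<forall>q\<in>F. dist (diff_quot f q n x) (q \<bullet> l) < \<epsilon>"
    using F dir eps by (intro eventually_ball_finite ballI tendstoD) auto
  then obtain N where N: "\<And>n q. N \<le> n \<Longrightarrow> q \<in> F \<Longrightarrow> \<bar>diff_quot f q n x - q \<bullet> l\<bar> < \<epsilon>"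
    by (auto simp: eventually_sequentially dist_real_def)
  have step: "norm (f (x + u) - f x - u \<bullet> l) \<le> e * norm u" if u: "norm u < 1 / real (Suc N)" "u \<noteq> 0" for u
  proof -
    \<comment> \<open>\<open>u\<close> is a step of length \<open>1 / m\<close> along \<open>w = m u\<close>, where \<open>1/2 \<le> norm w \<le> 1\<close>\<close>
    define m where "m = nat \<lfloor>1 / norm u\<rfloor>"
    have "real (Suc N) \<le> 1 / norm u" using u by (simp add: field_simps)
    then have mN: "Suc N \<le> m" unfolding m_def by (simp add: le_nat_floor)
    have floor: "real_of_int \<lfloor>1 / norm u\<rfloor> = real m" by (simp add: m_def)
    have "real m \<le> 1 / norm u" unfolding floor[symmetric] by (rule of_int_floor_le)
    then have m1: "real m * norm u \<le> 1" using u by (simp add: pos_le_divide_eq)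
    have "1 / norm u < real m + 1" unfolding floor[symmetric] by (rule real_of_int_floor_add_one_gt)
    then have "1 < (real m + 1) * norm u" using u by (simp add: pos_divide_less_eq)
    also have "\<dots> \<le> (2 * real m) * norm u" using mN by (intro mult_right_mono) auto
    finally have m2: "1 / 2 \<le> real m * norm u" by simp
    obtain n where n: "m = Suc n" "N \<le> n" using mN by (cases m) auto
    define w where "w = real m *\<^sub>R u"
    have "w \<in> cball 0 1" using m1 by (simp add: w_def)
    then obtain q where q: "q \<in> F" "norm (w - q) < \<epsilon>"
      using F by (auto simp: dist_norm norm_minus_commute)
    have "diff_quot f w n x = real m * (f (x + u) - f x)"
      using n by (simp add: diff_quot_def w_def del: of_nat_Suc)
    then have "real m * \<bar>f (x + u) - f x - u \<bullet> l\<bar> = \<bar>diff_quot f w n x - w \<bullet> l\<bar>"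
      by (simp add: w_def abs_mult flip: right_diff_distrib)
    also have "\<dots> \<le> \<bar>diff_quot f w n x - diff_quot f q n x\<bar> + \<bar>diff_quot f q n x - q \<bullet> l\<bar> + \<bar>(w - q) \<bullet> l\<bar>"
      by (simp add: inner_diff_left)
    also have "\<dots> \<le> L * \<epsilon> + \<epsilon> + \<epsilon> * norm l"
    proof (intro add_mono)
      show "\<bar>diff_quot f w n x - diff_quot f q n x\<bar> \<le> L * \<epsilon>"
        using abs_diff_quot_diff_le[OF lip, of w n x q] q \<open>0 \<le> L\<close>
        by (meson less_imp_le mult_left_mono order_trans)
      show "\<bar>diff_quot f q n x - q \<bullet> l\<bar> \<le> \<epsilon>" using N[OF n(2) q(1)] by simp
      show "\<bar>(w - q) \<bullet> l\<bar> \<le> \<epsilon> * norm l"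
        using Cauchy_Schwarz_ineq2[of "w - q" l] q
        by (meson less_imp_le mult_right_mono norm_ge_zero order_trans)
    qed
    also have "\<dots> = e * (1 / 2)" using eps(2) by (simp add: c_def algebra_simps)
    also have "\<dots> \<le> e * (real m * norm u)" using m2 \<open>e > 0\<close> by (intro mult_left_mono) auto
    finally have "real m * \<bar>f (x + u) - f x - u \<bullet> l\<bar> \<le> real m * (e * norm u)"
      by (simp add: mult.left_commute)
    then show ?thesis using n by simp
  qed
  have "norm (f y - f x - (y - x) \<bullet> l) \<le> e * norm (y - x)" if "norm (y - x) < 1 / real (Suc N)" for y
    using that step[of "y - x"] by (cases "y = x") auto
  then show "\<exists>d>0. \<forall>y. norm (y - x) < d \<longrightarrow> norm (f y - f x - (y - x) \<bullet> l) \<le> e * norm (y - x)"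
    by (intro exI[of _ "1 / real (Suc N)"]) auto
qed

theorem rademacher:
  fixes f :: "'a::euclidean_space \<Rightarrow> real"
  assumes lip: "L-lipschitz_on UNIV f"
  shows "AE x in lborel. f differentiable (at x)"
proof -
  let ?D = "\<lambda>v x. lim (\<lambda>n. diff_quot f v n x)"
  have "AE x in lborel. \<forall>v\<in>rational_vectors. (\<lambda>n. diff_quot f v n x) \<longlonglongrightarrow> ?D v x"
    using diff_quot_tendsto_lim_AE[OF lip] by (simp add: AE_ball_countable countable_rational_vectors)
  moreover have "AE x in lborel. \<forall>v\<in>rational_vectors. \<forall>w\<in>rational_vectors. ?D (v + w) x = ?D v x + ?D w x"
    using lim_diff_quot_add_AE[OF lip] by (simp add: AE_ball_countable countable_rational_vectors)
  ultimately show ?thesis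
  proof eventually_elim
    case (elim x)
    let ?l = "\<Sum>i\<in>Basis. ?D i x *\<^sub>R i"
    have "(\<lambda>n. diff_quot f q n x) \<longlonglongrightarrow> q \<bullet> ?l" if q: "q \<in> rational_vectors" for q
    proof -
      have "?D q x = q \<bullet> ?l"
        by (rule additive_on_rational_vectors[where D = "\<lambda>v. ?D v x", OF _ q]) (use elim(2) in blast)
      with elim(1) q show ?thesis by metis
    qed
    from lipschitz_has_derivative_of_rational_directions[OF lip this] show ?case
      by (rule differentiableI)
  qed
qed

section \<open>Minimizers of the CVaR objective\<close>

context prob_space
begin

context
  fixes g :: "'a \<Rightarrow> real" and \<alpha> :: real
  assumes g_int [measurable]: "integrable M g" and \<alpha>: "0 < \<alpha>" "\<alpha> < 1"
begin

section \<open>Slope bounds for the CVaR objective\<close>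

lemma CVaR_objective_diff_eq:
  "CVaR_objective \<alpha> M g z - CVaR_objective \<alpha> M g y =
     (z - y) - (\<integral>x. max (g x - y) 0 - max (g x - z) 0 \<partial>M) / (1 - \<alpha>)"
proof -
  have "integrable M (\<lambda>x. max (g x - c) 0)" for c
    using g_int by (intro integrable_max) auto
  then have "(\<integral>x. max (g x - y) 0 - max (g x - z) 0 \<partial>M) =
      (\<integral>x. max (g x - y) 0 \<partial>M) - (\<integral>x. max (g x - z) 0 \<partial>M)"
    by (intro Bochner_Integration.integral_diff)
  then show ?thesis by (simp add: CVaR_objective_def diff_divide_distrib)
qed

lemma integrable_max_diff: "integrable M (\<lambda>x. max (g x - y) 0 - max (g x - z) 0)"
  using g_int by (intro Bochner_Integration.integrable_diff integrable_max) auto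

text \<open>The difference of the two ramps vanishes where \<open>g <= y\<close> and never exceeds
  \<open>z - y\<close>, so its mean is at most \<open>z - y\<close> times the probability of
  \<open>g > y\<close>.\<close>

lemma CVaR_objective_diff_ge:
  assumes "y \<le> z"
  shows "(z - y) * (prob {x \<in> space M. g x \<le> y} - \<alpha>) / (1 - \<alpha>)
    \<le> CVaR_objective \<alpha> M g z - CVaR_objective \<alpha> M g y"
proof -
  let ?S = "{x \<in> space M. g x \<le> y}"
  have S: "?S \<in> events" by measurable
  have int: "integrable M (\<lambda>x. (z - y) * indicator (space M - ?S) x)"
    using S by (intro integrable_mult_right integrable_real_indicator) (auto simp: less_top[symmetric])
  have "(\<integral>x. max (g x - y) 0 - max (g x - z) 0 \<partial>M) \<le> (\<integral>x. (z - y) * indicator (space M - ?S) x \<partial>M)"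
    using assms by (intro integral_mono integrable_max_diff int) (auto simp: indicator_def max_def)
  also have "\<dots> = (z - y) * (1 - prob ?S)"
    using S by (simp add: prob_compl)
  finally have "(\<integral>x. max (g x - y) 0 - max (g x - z) 0 \<partial>M) / (1 - \<alpha>) \<le> (z - y) * (1 - prob ?S) / (1 - \<alpha>)"
    using \<alpha> by (intro divide_right_mono) auto
  moreover have "(z - y) * (prob ?S - \<alpha>) / (1 - \<alpha>) = (z - y) - (z - y) * (1 - prob ?S) / (1 - \<alpha>)"
    using \<alpha> by (simp add: field_simps)
  ultimately show ?thesis
    by (simp only: CVaR_objective_diff_eq diff_left_mono)
qed

text \<open>The difference of the two ramps equals \<open>z - y\<close> where \<open>g >= z\<close>
  and is nonnegative elsewhere; hence the strict inequality in the event
  \<open>g < z\<close>.\<close>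

lemma CVaR_objective_diff_le:
  assumes "y \<le> z"
  shows "CVaR_objective \<alpha> M g z - CVaR_objective \<alpha> M g y
    \<le> (z - y) * (prob {x \<in> space M. g x < z} - \<alpha>) / (1 - \<alpha>)"
proof -
  let ?S = "{x \<in> space M. g x < z}"
  have S: "?S \<in> events" by measurable
  have int: "integrable M (\<lambda>x. (z - y) * indicator (space M - ?S) x)"
    using S by (intro integrable_mult_right integrable_real_indicator) (auto simp: less_top[symmetric])
  have "(\<integral>x. (z - y) * indicator (space M - ?S) x \<partial>M) \<le> (\<integral>x. max (g x - y) 0 - max (g x - z) 0 \<partial>M)"
    using assms by (intro integral_mono integrable_max_diff int) (auto simp: indicator_def max_def)
  moreover have "(\<integral>x. (z - y) * indicator (space M - ?S) x \<partial>M) = (z - y) * (1 - prob ?S)"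
    using S by (simp add: prob_compl)
  ultimately have "(z - y) * (1 - prob ?S) / (1 - \<alpha>) \<le> (\<integral>x. max (g x - y) 0 - max (g x - z) 0 \<partial>M) / (1 - \<alpha>)"
    using \<alpha> by (intro divide_right_mono) auto
  moreover have "(z - y) * (prob ?S - \<alpha>) / (1 - \<alpha>) = (z - y) - (z - y) * (1 - prob ?S) / (1 - \<alpha>)"
    using \<alpha> by (simp add: field_simps)
  ultimately show ?thesis
    by (simp only: CVaR_objective_diff_eq diff_left_mono)
qed

section \<open>Quantiles through the distribution function\<close>

lemma cdf_distr: "cdf (distr M borel g) c = prob {x \<in> space M. g x \<le> c}"
  by (simp add: cdf_def measure_distr vimage_def Int_def conj_commute)

lemma prob_le_mono: "c \<le> d \<Longrightarrow> prob {x \<in> space M. g x \<le> c} \<le> prob {x \<in> space M. g x \<le> d}"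
  by (intro finite_measure_mono) auto

text \<open>The distribution function tends to 0 and 1 at the two ends and \<alpha> lies strictly
  between. This makes the infima defining both quantiles genuine ones, since \<open>Inf\<close> is
  unspecified for empty or unbounded sets.\<close>

lemma
  shows bdd_below_VaR_set: "bdd_below {c. prob {x \<in> space M. g x \<le> c} \<ge> \<alpha>}" (is "bdd_below ?S")
    and VaR_upper_set_nonempty: "{c. prob {x \<in> space M. g x \<le> c} > \<alpha>} \<noteq> {}" (is "?T \<noteq> {}")
proof -
  interpret D: real_distribution "distr M borel g" by simp
  have "\<forall>\<^sub>F c in at_bot. prob {x \<in> space M. g x \<le> c} < \<alpha>"
    using order_tendstoD(2)[OF D.cdf_lim_at_bot \<alpha>(1)] by (simp add: cdf_distr)
  then obtain N where "\<forall>c\<le>N. prob {x \<in> space M. g x \<le> c} < \<alpha>"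
    by (auto simp: eventually_at_bot_linorder)
  then show "bdd_below ?S"
    by (intro bdd_belowI[of _ N]) (metis mem_Collect_eq not_le linear)
  have "\<forall>\<^sub>F c in at_top. \<alpha> < prob {x \<in> space M. g x \<le> c}"
    using order_tendstoD(1)[OF D.cdf_lim_at_top_prob \<alpha>(2)] by (simp add: cdf_distr)
  then show "?T \<noteq> {}"
    by (auto simp: eventually_at_top_linorder)
qed

lemma VaR_le_VaR_upper: "VaR \<alpha> M g \<le> VaR_upper \<alpha> M g"
  unfolding VaR_def VaR_upper_def
  using bdd_below_VaR_set VaR_upper_set_nonempty by (intro cInf_superset_mono) auto

lemma prob_less_of_less_VaR: "c < VaR \<alpha> M g \<Longrightarrow> prob {x \<in> space M. g x \<le> c} < \<alpha>"
  unfolding VaR_def using cInf_lower[OF _ bdd_below_VaR_set, of c] by force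

lemma prob_le_of_less_VaR_upper:
  assumes "c < VaR_upper \<alpha> M g"
  shows "prob {x \<in> space M. g x \<le> c} \<le> \<alpha>"
proof -
  have "bdd_below {c. prob {x \<in> space M. g x \<le> c} > \<alpha>}"
    by (rule bdd_below_mono[OF bdd_below_VaR_set]) auto
  then show ?thesis
    using assms cInf_lower[of c "{c. prob {x \<in> space M. g x \<le> c} > \<alpha>}"]
    unfolding VaR_upper_def by force
qed

lemma prob_greater_of_greater_VaR_upper:
  assumes "VaR_upper \<alpha> M g < c"
  shows "\<alpha> < prob {x \<in> space M. g x \<le> c}"
proof -
  obtain d where "\<alpha> < prob {x \<in> space M. g x \<le> d}" "d < c"
    using cInf_lessD[OF VaR_upper_set_nonempty] assms unfolding VaR_upper_def by auto
  then show ?thesis using prob_le_mono[of d c] by linarith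
qed

text \<open>Right continuity of the distribution function carries the bound from levels above the
  quantile to the quantile itself, so the infimum is attained.\<close>

lemma prob_ge_of_ge_VaR:
  assumes "VaR \<alpha> M g \<le> c"
  shows "\<alpha> \<le> prob {x \<in> space M. g x \<le> c}"
proof -
  interpret D: real_distribution "distr M borel g" by simp
  have "{c. prob {x \<in> space M. g x \<le> c} \<ge> \<alpha>} \<noteq> {}"
    using VaR_upper_set_nonempty by (auto intro: less_imp_le)
  note ex = cInf_lessD[OF this]
  have "\<alpha> \<le> prob {x \<in> space M. g x \<le> d}" if d: "VaR \<alpha> M g < d" for d
  proof -
    obtain d' where "\<alpha> \<le> prob {x \<in> space M. g x \<le> d'}" "d' < d"
      using ex d unfolding VaR_def by auto
    then show ?thesis using prob_le_mono[of d' d] by linarith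
  qed
  then have "\<forall>\<^sub>F d in at_right (VaR \<alpha> M g). \<alpha> \<le> cdf (distr M borel g) d"
    by (auto simp: cdf_distr eventually_at_right_field intro: exI[of _ "VaR \<alpha> M g + 1"])
  moreover have "(cdf (distr M borel g) \<longlongrightarrow> cdf (distr M borel g) (VaR \<alpha> M g)) (at_right (VaR \<alpha> M g))"
    using D.cdf_is_right_cont by (simp add: continuous_within)
  ultimately have "\<alpha> \<le> cdf (distr M borel g) (VaR \<alpha> M g)"
    by (intro tendsto_lowerbound) auto
  also have "\<dots> \<le> cdf (distr M borel g) c"
    using assms by (rule D.cdf_nondecreasing)
  finally show ?thesis by (simp add: cdf_distr)
qed

text \<open>The probability of \<open>g < c\<close> is the left limit of the distribution function
  at \<open>c\<close>, so a jump at the upper quantile does no harm and \<open>c\<close> may equal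
  it.\<close>

lemma prob_less_VaR_upper_le:
  assumes "c \<le> VaR_upper \<alpha> M g"
  shows "prob {x \<in> space M. g x < c} \<le> \<alpha>"
proof -
  interpret D: real_distribution "distr M borel g" by simp
  have "\<forall>\<^sub>F d in at_left c. cdf (distr M borel g) d \<le> \<alpha>"
    using assms by (auto simp: cdf_distr eventually_at_left_field
        intro!: exI[of _ "c - 1"] prob_le_of_less_VaR_upper)
  then have "measure (distr M borel g) {..<c} \<le> \<alpha>"
    using D.cdf_at_left by (intro tendsto_upperbound) auto
  then show ?thesis
    by (simp add: measure_distr vimage_def Int_def conj_commute)
qed

theorem CVaR_minimizers_eq: "CVaR_minimizers \<alpha> M g = {VaR \<alpha> M g .. VaR_upper \<alpha> M g}"
proof -
  let ?F = "CVaR_objective \<alpha> M g"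
  let ?a = "VaR \<alpha> M g" and ?b = "VaR_upper \<alpha> M g"
  have incr: "?F y \<le> ?F z" if "?a \<le> y" "y \<le> z" for y z
  proof -
    have "0 \<le> (z - y) * (prob {x \<in> space M. g x \<le> y} - \<alpha>) / (1 - \<alpha>)"
      using that prob_ge_of_ge_VaR[of y] \<alpha> by simp
    then show ?thesis using CVaR_objective_diff_ge[OF that(2)] by linarith
  qed
  have decr: "?F z \<le> ?F y" if "y \<le> z" "z \<le> ?b" for y z
  proof -
    have "(z - y) * (prob {x \<in> space M. g x < z} - \<alpha>) / (1 - \<alpha>) \<le> 0"
      using that prob_less_VaR_upper_le[of z] \<alpha>
      by (simp add: divide_le_0_iff mult_le_0_iff)
    then show ?thesis using CVaR_objective_diff_le[OF that(1)] by linarith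
  qed
  \<comment> \<open>Since \<open>?a <= ?b\<close>, the lower quantile belongs to the range of both
    monotonicity statements.\<close>
  have min: "?F ?a \<le> ?F y" for y
    using incr[of ?a y] decr[of y ?a] VaR_le_VaR_upper by linarith
  have left: "?F ?a < ?F y" if "y < ?a" for y
  proof -
    \<comment> \<open>At \<open>?a\<close> itself the slope bound may be 0, as \<open>g < ?a\<close>
      can have probability exactly \<alpha>. An intermediate \<open>z\<close> gives a strict bound;
      the same device serves to the right of \<open>?b\<close>.\<close>
    obtain z where z: "y < z" "z < ?a" using dense[OF \<open>y < ?a\<close>] by auto
    have "prob {x \<in> space M. g x < z} \<le> prob {x \<in> space M. g x \<le> z}"
      by (intro finite_measure_mono) auto
    also have "\<dots> < \<alpha>" using z by (intro prob_less_of_less_VaR)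
    finally have "(z - y) * (prob {x \<in> space M. g x < z} - \<alpha>) / (1 - \<alpha>) < 0"
      using z \<alpha> by (simp add: divide_less_0_iff mult_less_0_iff)
    then have "?F z < ?F y" using CVaR_objective_diff_le[of y z] z by linarith
    with min[of z] show ?thesis by linarith
  qed
  have right: "?F ?a < ?F y" if "?b < y" for y
  proof -
    obtain z where z: "?b < z" "z < y" using dense[OF \<open>?b < y\<close>] by auto
    then have "0 < (y - z) * (prob {x \<in> space M. g x \<le> z} - \<alpha>) / (1 - \<alpha>)"
      using \<alpha> prob_greater_of_greater_VaR_upper[of z] by simp
    then have "?F z < ?F y" using CVaR_objective_diff_ge[of z y] z by linarith
    with min[of z] show ?thesis by linarith
  qed
  have "(\<forall>z. ?F y \<le> ?F z) \<longleftrightarrow> ?a \<le> y \<and> y \<le> ?b" for y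
  proof
    assume "\<forall>z. ?F y \<le> ?F z"
    then show "?a \<le> y \<and> y \<le> ?b" using left[of y] right[of y] by (meson not_le)
  next
    assume "?a \<le> y \<and> y \<le> ?b"
    then have "?F y \<le> ?F ?a" by (intro decr) auto
    with min show "\<forall>z. ?F y \<le> ?F z" using order_trans by blast
  qed
  then show ?thesis
    by (auto simp: CVaR_minimizers_def is_arg_min_linorder)
qed

text \<open>At a negative level the event \<open>g <= c\<close> is empty, while at the quantile it
  has probability at least \<alpha>. For \<open>y\<close> above the quantile, \<open>g x > y\<close>
  therefore excludes \<open>g x = 0\<close>, where \<open>g\<close> need not be
  differentiable.\<close>

lemma VaR_nonneg:
  assumes "\<And>x. x \<in> space M \<Longrightarrow> 0 \<le> g x"
  shows "0 \<le> VaR \<alpha> M g"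
proof (rule ccontr)
  assume "\<not> 0 \<le> VaR \<alpha> M g"
  then have "{x \<in> space M. g x \<le> VaR \<alpha> M g} = {}" using assms by force
  with prob_ge_of_ge_VaR[of "VaR \<alpha> M g"] \<alpha> show False by simp
qed

end

end

section \<open>Gradients of the potential\<close>

lemma grad_eqI: "GDERIV f x :> D \<Longrightarrow> grad f x = D"
proof -
  assume D: "GDERIV f x :> D"
  have "E = D" if "GDERIV f x :> E" for E
  proof -
    have "(\<lambda>h. inner h E) = (\<lambda>h. inner h D)"
      using that D unfolding gderiv_def by (rule has_derivative_unique)
    then have "\<forall>h. inner h E = inner h D" by (intro allI) (rule fun_cong)
    then show ?thesis by (simp only: vector_eq_ldot)
  qed
  with D show ?thesis unfolding grad_def by (rule the_equality)
qed

text \<open>Riesz representation in coordinates: the gradient collects the values of the derivative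
  on the basis.\<close>

lemma GDERIV_grad:
  fixes f :: "'a::euclidean_space \<Rightarrow> real"
  assumes "f differentiable (at x)"
  shows "GDERIV f x :> grad f x"
proof -
  obtain f' where f': "(f has_derivative f') (at x)"
    using assms by (auto simp: differentiable_def)
  interpret bounded_linear f' using f' by (rule has_derivative_bounded_linear)
  define D where "D = (\<Sum>i\<in>Basis. f' i *\<^sub>R i)"
  have "f' h = inner h D" for h
  proof -
    have "f' h = f' (\<Sum>i\<in>Basis. (h \<bullet> i) *\<^sub>R i)"
      by (simp add: euclidean_representation)
    then show ?thesis
      by (simp add: D_def sum scale inner_sum_right mult.commute)
  qed
  then have "f' = (\<lambda>h. inner h D)" by (rule ext)
  with f' have D: "GDERIV f x :> D"
    by (simp add: gderiv_def)
  then show ?thesis by (simp add: grad_eqI[OF D])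
qed

lemma GDERIV_imp_differentiable: "GDERIV f x :> D \<Longrightarrow> f differentiable (at x)"
  unfolding gderiv_def by (rule differentiableI)

lemma GDERIV_transform_open:
  assumes "GDERIV f x :> D" "open S" "x \<in> S" "\<And>z. z \<in> S \<Longrightarrow> f z = h z"
  shows "GDERIV h x :> D"
  using has_derivative_transform_within_open[OF assms(1)[unfolded gderiv_def] assms(2,3,4)]
  unfolding gderiv_def .

lemma GDERIV_positive_part_below:
  fixes g :: "'a::real_inner \<Rightarrow> real"
  assumes "continuous_on UNIV g" "g x < y"
  shows "GDERIV (\<lambda>z. max (g z - y) 0) x :> 0"
proof (rule GDERIV_transform_open[OF GDERIV_const])
  show "open {z. g z < y}" using assms(1) by (intro open_Collect_less) auto
qed (use assms in auto)

lemma GDERIV_positive_part_above: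
  fixes g :: "'a::real_inner \<Rightarrow> real"
  assumes "continuous_on UNIV g" "y < g x" and D: "GDERIV g x :> D"
  shows "GDERIV (\<lambda>z. max (g z - y) 0) x :> D"
proof (rule GDERIV_transform_open)
  show "GDERIV (\<lambda>z. g z - y) x :> D"
    using GDERIV_diff[OF D GDERIV_const, of y] by simp
  show "open {z. y < g z}" using assms(1) by (intro open_Collect_less) auto
qed (use assms in auto)

lemma grad_positive_part_at_level:
  fixes g :: "'a::euclidean_space \<Rightarrow> real"
  assumes diff: "(\<lambda>z. max (g z - y) 0) differentiable (at x)" and "g x = y"
  shows "grad (\<lambda>z. max (g z - y) 0) x = 0"
proof -
  let ?r = "\<lambda>z. max (g z - y) 0"
  \<comment> \<open>\<open>x\<close> is a global minimum of the positive part\<close>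
  have "(?r has_derivative (\<lambda>h. inner h (grad ?r x))) (at x)"
    using GDERIV_grad[OF diff] by (simp add: gderiv_def)
  then have "(\<lambda>h. inner h (grad ?r x)) = (\<lambda>h. 0)"
    using \<open>g x = y\<close> by (intro differential_zero_maxmin[OF UNIV_I open_UNIV]) auto
  from fun_cong[OF this, of "grad ?r x"] show ?thesis by simp
qed

text \<open>The ramp is a 1-Lipschitz function of \<open>g\<close>. Rademacher's theorem thus
  applies to the potential as a whole, with no separate analysis of the level set
  \<open>{g = y}\<close>.\<close>

lemma lipschitz_potential:
  assumes "L-lipschitz_on UNIV \<phi>" "K-lipschitz_on UNIV g"
  shows "\<exists>C. C-lipschitz_on UNIV (potential \<alpha> lam g P Q \<phi> y)"
proof -
  define c where "c = 2 * lam / (1 - \<alpha>) * CVaR_gap \<alpha> g Q P"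
  have "K-lipschitz_on UNIV (\<lambda>x. max (g x - y) 0)"
  proof (rule lipschitz_onI)
    fix u v
    have "\<bar>max (g u - y) 0 - max (g v - y) 0\<bar> \<le> \<bar>g u - g v\<bar>" by (auto simp: max_def abs_if)
    then show "dist (max (g u - y) 0) (max (g v - y) 0) \<le> K * dist u v"
      using lipschitz_onD[OF assms(2), of u v] by (simp add: dist_real_def)
  qed (rule lipschitz_on_nonneg[OF assms(2)])
  then have "(L + \<bar>c\<bar> * K)-lipschitz_on UNIV (potential \<alpha> lam g P Q \<phi> y)"
    unfolding potential_def c_def by (intro lipschitz_on_diff assms lipschitz_on_cmult_real)
  then show ?thesis by blast
qed

lemma GDERIV_potential:
  assumes "GDERIV \<phi> x :> D" "GDERIV (\<lambda>z. max (g z - y) 0) x :> E"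
  shows "GDERIV (potential \<alpha> lam g P Q \<phi> y) x :> D - (2 * lam / (1 - \<alpha>) * CVaR_gap \<alpha> g Q P) *\<^sub>R E"
proof -
  have "GDERIV (\<lambda>z. \<phi> z - c * max (g z - y) 0) x :> D - c *\<^sub>R E" for c
    using GDERIV_diff[OF assms(1) GDERIV_mult[OF GDERIV_const assms(2)]] by simp
  moreover have "potential \<alpha> lam g P Q \<phi> y =
      (\<lambda>z. \<phi> z - 2 * lam / (1 - \<alpha>) * CVaR_gap \<alpha> g Q P * max (g z - y) 0)"
    by (rule ext) (rule potential_def)
  ultimately show ?thesis by (simp only:)
qed

theorem theorem3p8:
  fixes \<alpha> lam L :: real
    and g \<phi> :: "real ^ 'd \<Rightarrow> real"
    and P Q :: "(real ^ 'd) measure"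
  assumes alpha: "0 < \<alpha>" "\<alpha> < 1"
    and lam: "lam > 0"
    and L: "L > 0"
    and g_nonneg: "\<forall>x. 0 \<le> g x"
    and g_lipschitz: "\<exists>K. K-lipschitz_on UNIV g"
    and g_C1: "\<forall>x. g x \<noteq> 0 \<longrightarrow> g differentiable (at x)"
      "continuous_on {x. g x \<noteq> 0} (grad g)"
    and P: "P \<in> space (prob_algebra borel)"
    and Q: "Q \<in> space (prob_algebra borel)"
    and P_g: "integrable P g"
    and Q_g: "integrable Q g"
    and Q_moment: "integrable Q (\<lambda>x. norm x)"
    and phi: "is_arg_max (DV_objective Q P) (\<lambda>\<psi>. \<psi> \<in> Lip_space L) \<phi>"
  shows "CVaR_minimizers \<alpha> Q g = {VaR \<alpha> Q g .. VaR_upper \<alpha> Q g} \<and>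
    (\<forall>y \<in> CVaR_minimizers \<alpha> Q g.
      (AE x in lborel. \<phi> differentiable (at x) \<and>
         potential \<alpha> lam g P Q \<phi> y differentiable (at x)) \<and>
      (\<forall>x. \<phi> differentiable (at x) \<and> g x \<noteq> y \<longrightarrow>
         potential \<alpha> lam g P Q \<phi> y differentiable (at x)) \<and>
      (\<forall>x. \<phi> differentiable (at x) \<and> potential \<alpha> lam g P Q \<phi> y differentiable (at x) \<longrightarrow>
         velocity \<alpha> lam g P Q \<phi> y x =
           (if g x > y
            then - grad \<phi> x + (2 * lam / (1 - \<alpha>) * CVaR_gap \<alpha> g Q P) *\<^sub>R grad g x
            else - grad \<phi> x))) \<and>
    (is_singleton (CVaR_minimizers \<alpha> Q g) \<longrightarrow>
      velocity \<alpha> lam g P Q \<phi> ` CVaR_minimizers \<alpha> Q g =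
        {velocity \<alpha> lam g P Q \<phi> (VaR \<alpha> Q g)})"
proof -
  let ?c = "2 * lam / (1 - \<alpha>) * CVaR_gap \<alpha> g Q P"
  let ?a = "VaR \<alpha> Q g" and ?b = "VaR_upper \<alpha> Q g"
  let ?pot = "potential \<alpha> lam g P Q \<phi>"
  interpret Q: prob_space Q using Q by (simp add: space_prob_algebra)
  have min: "CVaR_minimizers \<alpha> Q g = {?a..?b}"
    using Q_g alpha by (rule Q.CVaR_minimizers_eq)
  have phi_lip: "L-lipschitz_on UNIV \<phi>"
    using phi by (simp add: is_arg_max_def Lip_space_def)
  obtain K where K: "K-lipschitz_on UNIV g" using g_lipschitz by blast
  then have g_cont: "continuous_on UNIV g" by (rule lipschitz_on_continuous_on)
  have a_nonneg: "0 \<le> ?a"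
    using Q_g alpha g_nonneg by (intro Q.VaR_nonneg) auto
  have ramp: "GDERIV (\<lambda>z. max (g z - y) 0) x :> (if g x > y then grad g x else 0)"
    if "?a \<le> y" "g x \<noteq> y" for x y
  proof (cases "g x > y")
    case True
    then have "g x \<noteq> 0" using that a_nonneg by linarith
    then have "GDERIV g x :> grad g x" using g_C1(1) by (intro GDERIV_grad) blast
    with True show ?thesis using GDERIV_positive_part_above[OF g_cont] by simp
  next
    case False
    with that show ?thesis using GDERIV_positive_part_below[OF g_cont] by simp
  qed
  have AE: "AE x in lborel. \<phi> differentiable (at x) \<and> ?pot y differentiable (at x)" for y
  proof -
    obtain C where "C-lipschitz_on UNIV (?pot y)"
      using lipschitz_potential[OF phi_lip K] by blast
    from rademacher[OF phi_lip] rademacher[OF this] show ?thesis by (rule AE_conjI)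
  qed
  have diff: "?pot y differentiable (at x)" if "?a \<le> y" "\<phi> differentiable (at x)" "g x \<noteq> y" for x y
    using GDERIV_potential[OF GDERIV_grad[OF that(2)] ramp[OF that(1,3)]]
    by (rule GDERIV_imp_differentiable)
  have vel: "velocity \<alpha> lam g P Q \<phi> y x =
      (if g x > y then - grad \<phi> x + ?c *\<^sub>R grad g x else - grad \<phi> x)"
    if "?a \<le> y" and phi': "\<phi> differentiable (at x)" and pot': "?pot y differentiable (at x)" for x y
  proof -
    have "grad (?pot y) x = grad \<phi> x - ?c *\<^sub>R (if g x > y then grad g x else 0)"
    \<comment> \<open>With coefficient 0 the potential is \<phi> and says nothing about the ramp,
      but the ramp term then drops out of the claim as well.\<close>
    proof (cases "?c = 0")
      case True
      have "?pot y = \<phi>"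
      proof
        show "?pot y z = \<phi> z" for z unfolding potential_def True by simp
      qed
      then show ?thesis unfolding True by simp
    next
      case False
      let ?r = "\<lambda>z. max (g z - y) 0"
      have "GDERIV ?r x :> (if g x > y then grad g x else 0)"
      proof (cases "g x = y")
        case True
        have "\<phi> z - ?pot y z = ?c * ?r z" for z
          unfolding potential_def by simp
        \<comment> \<open>Solving the definition of the potential for the ramp shows it
          differentiable on the level set, where no derivative of \<open>g\<close> is at
          hand.\<close>
        then have r_eq: "?r = (\<lambda>z. (\<phi> z - ?pot y z) / ?c)"
          using False by (simp only: nonzero_mult_div_cancel_left not_False_eq_True)
        have "(\<lambda>z. (\<phi> z - ?pot y z) / ?c) differentiable (at x)"
          by (intro differentiable_divide differentiable_diff differentiable_const phi' pot' False)
        then have "?r differentiable (at x)" unfolding r_eq .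
        from GDERIV_grad[OF this] grad_positive_part_at_level[OF this True]
        show ?thesis using True by simp
      qed (rule ramp[OF \<open>?a \<le> y\<close>])
      from GDERIV_potential[OF GDERIV_grad[OF phi'] this] show ?thesis by (rule grad_eqI)
    qed
    then show ?thesis by (simp add: velocity_def)
  qed
  show ?thesis
    unfolding min
  proof (intro conjI ballI impI)
    fix y assume "y \<in> {?a..?b}"
    then have y: "?a \<le> y" by simp
    show "AE x in lborel. \<phi> differentiable (at x) \<and> ?pot y differentiable (at x)"
      by (rule AE)
    show "\<forall>x. \<phi> differentiable (at x) \<and> g x \<noteq> y \<longrightarrow> ?pot y differentiable (at x)"
      by (intro allI impI diff[OF y]) simp_all
    show "\<forall>x. \<phi> differentiable (at x) \<and> ?pot y differentiable (at x) \<longrightarrow>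
        velocity \<alpha> lam g P Q \<phi> y x =
          (if g x > y then - grad \<phi> x + ?c *\<^sub>R grad g x else - grad \<phi> x)"
      by (intro allI impI vel[OF y]) simp_all
  next
    assume "is_singleton {?a..?b}"
    then obtain z where z: "{?a..?b} = {z}" by (rule is_singletonE)
    moreover have "?a \<in> {?a..?b}" using Q.VaR_le_VaR_upper[OF Q_g alpha] by simp
    ultimately have "?a = z" by blast
    then show "velocity \<alpha> lam g P Q \<phi> ` {?a..?b} = {velocity \<alpha> lam g P Q \<phi> ?a}"
      unfolding z by simp
  qed (rule refl)
qed

end
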